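(* For every integer $m\ge 0$, $$\sum_{k=2}^\infty (\zeta(k)-1) F_{k+m-1} = F_{m+1} + F_{m-1}\frac{\pi}{\sqrt{5}}\tan\!\Big(\frac{\sqrt{5}\,\pi}{2}\Big)+ F_{m} \sum_{n=1}^\infty \frac{1}{n(n^2+n-1)}$$ and $$\sum_{k=2}^\infty (\zeta(k)-1) L_{k+m-1}= L_{m+1} + L_{m-1}\frac{\pi}{\sqrt{5}}\tan\!\Big(\frac{\sqrt{5}\,\pi}{2}\Big)+ L_{m} \sum_{n=1}^\infty \frac{1}{n(n^2+n-1)}.$$
   Context: $\zeta$ is the Riemann zeta function, $\zeta(s)=\sum_{n\ge1} n^{-s}$ for $\Re(s)>1$. The Fibonacci numbers $F_n$ and Lucas numbers $L_n$ are defined by $F_0=0$, $F_1=1$, $L_0=2$, $L_1=1$, $F_{n+2}=F_{n+1}+F_n$, $L_{n+2}=L_{n+1}+L_n$, and are extended to negative indices by $F_{-n}=(-1)^{n+1}F_n$ and $L_{-n}=(-1)^nL_n$ (so $F_{-1}=1$, $L_{-1}=-1$). *)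

theory Defs
  imports "HOL-Analysis.Analysis" "HOL-Number_Theory.Fib"
begin

text \<open>
  The Riemann zeta function on its half-plane of convergence, for real and complex arguments
  alike. The series converges for \<open>Re s > 1\<close> only; elsewhere the value carries no meaning
  (no analytic continuation is involved).
\<close>
definition zeta :: "'a :: ln \<Rightarrow> 'a" where
  "zeta s = (\<Sum>n. of_nat (Suc n) powr (-s))"

lemma zeta_complex_of_real:
  assumes "s > 1"
  shows "zeta (complex_of_real s) = complex_of_real (zeta s)"
proof -
  have *: "of_nat (Suc n) powr - complex_of_real s = complex_of_real (real (Suc n) powr -s)" for n
    using powr_of_real[of "real (Suc n)" "-s"] by simp
  have "summable (\<lambda>n. real (Suc n) powr -s)"
    using summable_real_powr_iff[of "-s"] assms
    by (subst summable_Suc_iff) auto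
  then show ?thesis
    unfolding zeta_def * by (rule suminf_of_real [symmetric])
qed

fun lucas_nat :: "nat \<Rightarrow> nat" where
  "lucas_nat 0 = 2"
| "lucas_nat (Suc 0) = 1"
| "lucas_nat (Suc (Suc n)) = lucas_nat (Suc n) + lucas_nat n"

text \<open>
  Fibonacci and Lucas numbers with integer index, extended to negative indices by
  \<open>F\<^bsub>-n\<^esub> = (-1)\<^bsup>n+1\<^esup> F\<^bsub>n\<^esub>\<close> and \<open>L\<^bsub>-n\<^esub> = (-1)\<^bsup>n\<^esup> L\<^bsub>n\<^esub>\<close>.
\<close>
definition fibonacci :: "int \<Rightarrow> int" where
  "fibonacci i =
     (if i \<ge> 0 then int (fib (nat i)) else (-1) ^ (nat (-i) + 1) * int (fib (nat (-i))))"

definition lucas :: "int \<Rightarrow> int" where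
  "lucas i =
     (if i \<ge> 0 then int (lucas_nat (nat i)) else (-1) ^ nat (-i) * int (lucas_nat (nat (-i))))"

lemma fibonacci_neg: "fibonacci (- int n) = (-1) ^ (n + 1) * fibonacci (int n)"
  by (cases n) (auto simp: fibonacci_def nat_add_distrib)

lemma lucas_neg: "lucas (- int n) = (-1) ^ n * lucas (int n)"
  by (cases n) (auto simp: lucas_def nat_add_distrib)

lemma fibonacci_minus_1: "fibonacci (-1) = 1"
  by (simp add: fibonacci_def)

lemma lucas_minus_1: "lucas (-1) = -1"
  by (simp add: lucas_def)

end

theory Submission
  imports Defs
begin

text \<open>
  Write \<open>\<zeta>(k) - 1 = (\<Sum>n\<ge>2. 1 / n ^ k)\<close> and interchange the two summations. For any nonnegative
  sequence \<open>g\<close> with \<open>g (n + 2) = g (n + 1) + g n\<close>, the inner sum is then the value at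
  \<open>x = 1 / n\<close> of the generating function
  \<open>(\<Sum>k. g (k + 1) x ^ (k + 2)) = x\<^sup>2 (g 1 + g 0 x) / (1 - x - x\<^sup>2)\<close>, which is within the radius of
  convergence because \<open>x \<le> 1 / 2\<close> (lemma \<open>fib_like_gen_fun\<close>). With \<open>n = N + 1\<close> the denominator
  becomes \<open>n\<^sup>2 - n - 1 = N\<^sup>2 + N - 1\<close>, so the sum over \<open>n\<close> is
  \<open>g 1 * A + g 0 * (\<Sum>N\<ge>1. 1 / ((N + 1) (N\<^sup>2 + N - 1)))\<close> with \<open>A = (\<Sum>N\<ge>1. 1 / (N\<^sup>2 + N - 1))\<close>.

  The second sum reduces to \<open>A\<close> and \<open>S = (\<Sum>N\<ge>1. 1 / (N (N\<^sup>2 + N - 1)))\<close>: since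
  \<open>1 / (u (u - 1)) = 1 / (u - 1) - 1 / u\<close> for \<open>u = N (N + 1)\<close>, and \<open>(\<Sum>N\<ge>1. 1 / (N (N + 1))) = 1\<close>,
  it equals \<open>S - A + 1\<close>. Finally \<open>N\<^sup>2 + N - 1 = (N + 1 / 2)\<^sup>2 - 5 / 4\<close>, and the partial fraction
  expansion of the tangent at \<open>\<surd>5 / 2\<close> gives \<open>A = 1 + \<pi> / \<surd>5 * tan (\<surd>5 \<pi> / 2)\<close>, the leading \<open>1\<close>
  compensating the term \<open>N = 0\<close> of that expansion (lemma \<open>sums_golden_quadratic\<close>). The
  expansion itself is the reflection formula of the digamma function, in which the
  difference of two digamma series is taken term by term.

  The Fibonacci and Lucas cases are \<open>g n = F\<^bsub>m+n\<^esub>\<close> and \<open>g n = L\<^bsub>m+n\<^esub>\<close>; the identity is linear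
  in \<open>g 0\<close> and \<open>g 1\<close>, and \<open>g 1 - g 0\<close> is the entry at index \<open>m - 1\<close>. The restriction to
  nonnegative \<open>g\<close> lets the interchange rest on monotone summation alone.
\<close>

section \<open>The partial fraction expansion of the tangent\<close>

text \<open>This is the logarithmic derivative of \<open>\<Gamma>(z) \<Gamma>(1 - z) = \<pi> / sin (\<pi> z)\<close>. It is taken in
  the form \<open>rGamma z * rGamma (1 - z) = sin (\<pi> z) / \<pi>\<close>, where all factors are entire.\<close>
lemma Digamma_reflection_complex:
  fixes z :: complex
  assumes z: "z \<notin> \<int>"
  shows "Digamma (1 - z) - Digamma z = of_real pi * cot (of_real pi * z)"
proof -
  define P where "P = rGamma z * rGamma (1 - z)"
  have nz: "z \<notin> \<int>\<^sub>\<le>\<^sub>0" "1 - z \<notin> \<int>\<^sub>\<le>\<^sub>0"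
    using z nonpos_Ints_subset_Ints Ints_diff[of 1 "1 - z"] by auto
  have P: "P = sin (of_real pi * z) / of_real pi"
    unfolding P_def by (rule rGamma_reflection_complex)
  have "P \<noteq> 0"
    using nz by (simp add: P_def rGamma_eq_zero_iff)
  have refl: "(\<lambda>w. rGamma w * rGamma (1 - w)) = (\<lambda>w::complex. sin (of_real pi * w) / of_real pi)"
    by (intro ext rGamma_reflection_complex)
  have "((\<lambda>w. rGamma w * rGamma (1 - w)) has_field_derivative P * (Digamma (1 - z) - Digamma z)) (at z)"
    using nz unfolding P_def
    by (auto intro!: derivative_eq_intros
          simp: has_field_derivative_rGamma_no_nonpos_int algebra_simps)
  moreover have "((\<lambda>w::complex. sin (of_real pi * w) / of_real pi)
                   has_field_derivative cos (of_real pi * z)) (at z)"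
    by (auto intro!: derivative_eq_intros)
  ultimately have "P * (Digamma (1 - z) - Digamma z) = cos (of_real pi * z)"
    unfolding refl by (rule DERIV_unique)
  with \<open>P \<noteq> 0\<close> show ?thesis
    by (auto simp: P cot_def field_simps)
qed

lemma Digamma_reflection_real:
  fixes x :: real
  assumes "x \<notin> \<int>"
  shows "Digamma (1 - x) - Digamma x = pi * cot (pi * x)"
proof -
  have "x \<noteq> 0" "1 - x \<noteq> 0"
    using assms by auto
  then have "Digamma (complex_of_real x) = of_real (Digamma x)"
    and "Digamma (complex_of_real (1 - x)) = of_real (Digamma (1 - x))"
    by (simp_all only: Polygamma_of_real not_False_eq_True)
  then have "complex_of_real (Digamma (1 - x) - Digamma x) = complex_of_real (pi * cot (pi * x))"
    using Digamma_reflection_complex[of "of_real x"] assms by (simp add: cot_of_real)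
  then show ?thesis
    unfolding of_real_eq_iff .
qed

text \<open>The digamma series at \<open>1 / 2 + x\<close> and \<open>1 / 2 - x\<close> differ by
  \<open>1 / (n + 1 / 2 - x) - 1 / (n + 1 / 2 + x)\<close> in the \<open>n\<close>th term. These two points are exchanged by
  \<open>z \<mapsto> 1 - z\<close>, and \<open>cot (\<pi> (1 / 2 - x)) = tan (\<pi> x)\<close>.\<close>
lemma tan_partial_fractions:
  fixes x :: real
  assumes x: "x + 1/2 \<notin> \<int>"
  shows "(\<lambda>n. 2 * x / ((real n + 1/2)\<^sup>2 - x\<^sup>2)) sums (pi * tan (pi * x))"
proof -
  have x': "1/2 - x \<notin> \<int>"
    using x Ints_diff[of 1 "1/2 - x"] by (auto simp: algebra_simps)
  have Digamma_series: "(\<lambda>n. inverse (of_nat (Suc n)) - inverse (z + of_nat n)) sums (Digamma z + euler_mascheroni)"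
    if "z \<notin> \<int>" for z :: real
    using summable_sums[OF summable_Digamma[of z]] that by (cases "z = 0") (auto simp: Digamma_def)
  have "(\<lambda>n. inverse (1/2 - x + real n) - inverse (x + 1/2 + real n)) sums (Digamma (x + 1/2) - Digamma (1/2 - x))"
    using sums_diff[OF Digamma_series[OF x] Digamma_series[OF x']] by simp
  moreover have "inverse (1/2 - x + real n) - inverse (x + 1/2 + real n)
                   = 2 * x / ((real n + 1/2)\<^sup>2 - x\<^sup>2)" for n
  proof -
    have "1/2 - x + real n \<noteq> 0" "x + 1/2 + real n \<noteq> 0"
      using Ints_minus[of "real n"] x x' by (auto simp: add_eq_0_iff2)
    then have "inverse (1/2 - x + real n) - inverse (x + 1/2 + real n)
                 = ((x + 1/2 + real n) - (1/2 - x + real n)) / ((1/2 - x + real n) * (x + 1/2 + real n))"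
      unfolding inverse_eq_divide by (subst diff_frac_eq) auto
    also have "(x + 1/2 + real n) - (1/2 - x + real n) = 2 * x"
      by simp
    also have "(1/2 - x + real n) * (x + 1/2 + real n) = (real n + 1/2)\<^sup>2 - x\<^sup>2"
      by (simp add: power2_eq_square algebra_simps)
    finally show ?thesis .
  qed
  moreover have "Digamma (x + 1/2) - Digamma (1/2 - x) = pi * tan (pi * x)"
  proof -
    have "Digamma (x + 1/2) - Digamma (1/2 - x) = pi * cot (pi * (1/2 - x))"
      using Digamma_reflection_real[OF x'] by (simp add: algebra_simps)
    also have "pi * (1/2 - x) = pi/2 - pi * x"
      by (simp add: algebra_simps)
    finally show ?thesis
      by (simp add: cot_def tan_def sin_diff cos_diff)
  qed
  ultimately show ?thesis
    by simp
qed

section \<open>Three series\<close>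

lemma sums_golden_quadratic:
  "(\<lambda>n. 1 / ((real (n + 1))\<^sup>2 + real (n + 1) - 1)) sums (1 + pi / sqrt 5 * tan (sqrt 5 * pi / 2))"
proof -
  have "sqrt 5 / 2 + 1/2 \<notin> \<int>"
  proof
    assume "sqrt 5 / 2 + 1/2 \<in> \<int>"
    then obtain i :: int where i: "sqrt 5 / 2 + 1/2 = of_int i"
      by (elim Ints_cases)
    have "1 < sqrt (5::real)" "sqrt (5::real) < 3"
      by (auto intro: real_less_rsqrt real_less_lsqrt)
    then have "(1::real) < of_int i" "of_int i < (2::real)"
      using i by linarith+
    then show False
      by simp
  qed
  from sums_divide[OF tan_partial_fractions[OF this], of "sqrt 5"]
  have "(\<lambda>n. 2 * (sqrt 5 / 2) / ((real n + 1/2)\<^sup>2 - (sqrt 5 / 2)\<^sup>2) / sqrt 5)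
          sums (pi / sqrt 5 * tan (sqrt 5 * pi / 2))"
    by (simp add: mult.commute)
  moreover have "(real n + 1/2)\<^sup>2 - (sqrt 5 / 2)\<^sup>2 = (real n)\<^sup>2 + real n - 1" for n
    by (simp add: power_divide power2_sum)
  ultimately have "(\<lambda>n. 1 / ((real n)\<^sup>2 + real n - 1)) sums (pi / sqrt 5 * tan (sqrt 5 * pi / 2))"
    by simp
  from sums_split_initial_segment[OF this, of 1] show ?thesis
    by (simp add: add.commute)
qed

lemma sums_inverse_pronic: "(\<lambda>n. 1 / (real (n + 1) * real (n + 2))) sums 1"
proof -
  have "(\<lambda>n. inverse (real (n + 1)) - inverse (real (Suc n + 1))) sums (inverse (real (0 + 1)) - 0)"
    by (intro telescope_sums') (use LIMSEQ_inverse_real_of_nat in simp)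
  moreover have "inverse (real (n + 1)) - inverse (real (Suc n + 1)) = 1 / (real (n + 1) * real (n + 2))" for n
    by (simp add: divide_simps)
  ultimately show ?thesis
    by simp
qed

lemma golden_quadratic_pos: "0 < (real (n + 1))\<^sup>2 + real (n + 1) - 1"
proof -
  have "(real (n + 1))\<^sup>2 + real (n + 1) - 1 = 1 + (real n * real n + 3 * real n)"
    by (simp add: power2_eq_square algebra_simps)
  also have "\<dots> > 0"
    by (simp add: add_pos_nonneg)
  finally show ?thesis .
qed

lemma summable_golden_cubic: "summable (\<lambda>n. 1 / (real (n + 1) * ((real (n + 1))\<^sup>2 + real (n + 1) - 1)))"
proof (rule summable_comparison_test'[OF sums_summable[OF sums_golden_quadratic]])
  fix n :: nat
  define q where "q = (real (n + 1))\<^sup>2 + real (n + 1) - 1"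
  have q: "q > 0" "1 * q \<le> real (n + 1) * q"
    using golden_quadratic_pos[of n] by (auto simp: q_def intro!: mult_right_mono)
  then have "1 / (real (n + 1) * q) \<le> 1 / q"
    by (intro divide_left_mono) auto
  then show "norm (1 / (real (n + 1) * ((real (n + 1))\<^sup>2 + real (n + 1) - 1)))
               \<le> 1 / ((real (n + 1))\<^sup>2 + real (n + 1) - 1)"
    unfolding q_def[symmetric] using q by simp
qed

text \<open>With \<open>u = b a = r + 1\<close>, moving \<open>1 / (a r)\<close> to the other side turns this into
  \<open>1 / (b r) - 1 / (a r) = 1 / (u (u - 1)) = 1 / (u - 1) - 1 / u\<close>.\<close>
lemma shifted_cubic_split:
  fixes a b r :: real
  assumes "a > 0" "b > 0" "r > 0" and r: "r = b * a - 1" and a: "a = b + 1"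
  shows "1 / (a * r) = 1 / (b * r) - 1 / r + 1 / (b * a)"
proof -
  have "1 / (b * r) - 1 / r + 1 / (b * a) = (a - b * a + r) / (a * b * r)"
    using assms(1-3) by (simp add: field_simps)
  also have "a - b * a + r = b"
    using r a by simp
  finally show ?thesis
    using assms(1-3) by simp
qed

section \<open>Sequences with the Fibonacci recurrence\<close>

text \<open>The ratio \<open>5 / 3\<close> may be any number between the golden ratio, where
  \<open>r\<^sup>2 \<ge> r + 1\<close> begins to hold, and \<open>2\<close>, where the series at \<open>x = 1 / 2\<close> stops converging.\<close>
lemma fib_like_growth:
  fixes g :: "nat \<Rightarrow> real"
  assumes rec: "\<And>n. g (n + 2) = g (n + 1) + g n" and pos: "\<And>n. g n \<ge> 0"
  shows "g n \<le> (g 0 + g 1) * (5/3) ^ n"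
proof (induction n rule: less_induct)
  case (less n)
  consider "n = 0" | "n = 1" | k where "n = k + 2"
    by (metis One_nat_def Suc_1 add.commute add_Suc_right not0_implies_Suc plus_1_eq_Suc)
  then show ?case
  proof cases
    case 3
    have "g n \<le> (g 0 + g 1) * (5/3) ^ (k + 1) + (g 0 + g 1) * (5/3) ^ k"
      using less[of k] less[of "k + 1"] rec[of k] 3 by simp
    also have "\<dots> = (g 0 + g 1) * (5/3) ^ k * (8/3)"
      by (simp add: field_simps)
    also have "\<dots> \<le> (g 0 + g 1) * (5/3) ^ k * (25/9)"
      using pos[of 0] pos[of 1] by (intro mult_left_mono) auto
    also have "\<dots> = (g 0 + g 1) * (5/3) ^ n"
      by (simp add: 3)
    finally show ?thesis .
  qed (use pos[of 0] pos[of 1] in \<open>auto simp: algebra_simps\<close>)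
qed

lemma fib_like_gen_fun:
  fixes g :: "nat \<Rightarrow> real"
  assumes rec: "\<And>n. g (n + 2) = g (n + 1) + g n" and pos: "\<And>n. g n \<ge> 0"
    and x: "0 < x" "x \<le> 1/2"
  shows "(\<lambda>k. g (k + 1) * x ^ (k + 2)) sums (x\<^sup>2 * (g 1 + g 0 * x) / (1 - x - x\<^sup>2))"
proof -
  have summ: "summable (\<lambda>k. g k * x ^ k)"
  proof (rule summable_comparison_test')
    show "summable (\<lambda>k. (g 0 + g 1) * (5/6) ^ k)"
      by (intro summable_mult summable_geometric) auto
    fix k
    have "g k * x ^ k \<le> ((g 0 + g 1) * (5/3) ^ k) * (1/2) ^ k"
      using fib_like_growth[of g, OF rec pos] x pos
      by (intro mult_mono power_mono) auto
    also have "\<dots> = (g 0 + g 1) * (5/6) ^ k"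
      by (simp add: power_mult_distrib[symmetric] mult.assoc)
    finally show "norm (g k * x ^ k) \<le> (g 0 + g 1) * (5/6) ^ k"
      using pos[of k] x by simp
  qed
  define G where "G = (\<Sum>k. g k * x ^ k)"
  have G0: "(\<lambda>k. g k * x ^ k) sums G"
    unfolding G_def using summ by (rule summable_sums)
  have G1: "(\<lambda>k. g (k + 1) * x ^ (k + 1)) sums (G - g 0)"
    using sums_split_initial_segment[OF G0, of 1] by simp
  have G2: "(\<lambda>k. g (k + 2) * x ^ (k + 2)) sums (G - g 0 - g 1 * x)"
    using sums_split_initial_segment[OF G0, of 2] by (simp add: numeral_2_eq_2 diff_diff_eq)
  have "(\<lambda>k. x * (g (k + 1) * x ^ (k + 1)) + x\<^sup>2 * (g k * x ^ k)) sums (x * (G - g 0) + x\<^sup>2 * G)"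
    by (intro sums_add sums_mult G0 G1)
  moreover have "x * (g (k + 1) * x ^ (k + 1)) + x\<^sup>2 * (g k * x ^ k) = g (k + 2) * x ^ (k + 2)" for k
    unfolding rec by (simp add: power2_eq_square algebra_simps)
  ultimately have "G - g 0 - g 1 * x = x * (G - g 0) + x\<^sup>2 * G"
    using G2 sums_unique2 by simp
  then have G: "(G - g 0) * (1 - x - x\<^sup>2) = x * (g 1 + g 0 * x)"
    by (simp add: power2_eq_square algebra_simps)
  have "x\<^sup>2 \<le> (1/2)\<^sup>2"
    using x by (intro power_mono) auto
  then have "1 - x - x\<^sup>2 > 0"
    using x by (simp add: power2_eq_square)
  with G have "G - g 0 = x * (g 1 + g 0 * x) / (1 - x - x\<^sup>2)"
    by (simp add: eq_divide_eq)
  then have "x * (G - g 0) = x\<^sup>2 * (g 1 + g 0 * x) / (1 - x - x\<^sup>2)"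
    by (simp add: power2_eq_square)
  moreover have "(\<lambda>k. g (k + 1) * x ^ (k + 2)) sums (x * (G - g 0))"
    using sums_mult[OF G1, of x] by (simp add: algebra_simps)
  ultimately show ?thesis
    by simp
qed

section \<open>The zeta series\<close>

lemma zeta_minus_1_sums: "(\<lambda>n. (1 / real (n + 2)) ^ (k + 2)) sums (zeta (real (k + 2)) - 1)"
proof -
  have eq: "real (Suc n) powr (- real (k + 2)) = (1 / real (n + 1)) ^ (k + 2)" for n
    by (simp only: powr_minus powr_realpow of_nat_0_less_iff zero_less_Suc)
       (simp add: power_divide field_simps)
  have "summable (\<lambda>n. real (Suc n) powr (- real (k + 2)))"
    using summable_real_powr_iff[of "- real (k + 2)"] by (subst summable_Suc_iff) auto
  then have "(\<lambda>n. (1 / real (n + 1)) ^ (k + 2)) sums zeta (real (k + 2))"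
    unfolding zeta_def eq by (rule summable_sums)
  from sums_split_initial_segment[OF this, of 1] show ?thesis
    by simp
qed

lemma sums_swap_nonneg:
  fixes f :: "nat \<Rightarrow> nat \<Rightarrow> real"
  assumes nonneg: "\<And>n k. f n k \<ge> 0"
    and rows: "\<And>n. f n sums r n" and total: "r sums S"
    and cols: "\<And>k. (\<lambda>n. f n k) sums c k"
  shows "c sums S"
proof -
  have rows': "(f n has_sum r n) UNIV" for n
    using rows nonneg by (rule sums_nonneg_imp_has_sum)
  have cols': "((\<lambda>n. f n k) has_sum c k) UNIV" for k
    using cols nonneg by (rule sums_nonneg_imp_has_sum)
  have "r n \<ge> 0" for n
    using rows'[of n] nonneg by (rule has_sum_nonneg)
  with total have total': "(r has_sum S) UNIV"
    by (rule sums_nonneg_imp_has_sum)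
  have "((\<lambda>(n, k). f n k) has_sum S) (UNIV \<times> UNIV)"
    using rows' total' nonneg has_sum_imp_summable[OF total']
    by (intro has_sum_SigmaI[where g = r] summable_on_SigmaI[where g = r]) auto
  then have "((\<lambda>(k, n). f n k) has_sum S) (UNIV \<times> UNIV)"
    by (subst (asm) has_sum_swap) simp
  then have "(c has_sum S) UNIV"
    by (rule has_sum_SigmaD) (use cols' in simp)
  then show ?thesis
    by (rule has_sum_imp_sums)
qed

text \<open>The two instances differ only in \<open>g 0\<close> and \<open>g 1\<close>. The coefficient \<open>g 1 - g 0\<close> stands
  for the entry before \<open>g 0\<close>, which may be negative, as it is for \<open>L\<^bsub>-1\<^esub>\<close>.\<close>
lemma zeta_fib_like_sums:
  fixes g :: "nat \<Rightarrow> real"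
  assumes rec: "\<And>n. g (n + 2) = g (n + 1) + g n" and pos: "\<And>n. g n \<ge> 0"
  shows "(\<lambda>k. (zeta (real (k + 2)) - 1) * g (k + 1)) sums
           (g 1 + (g 1 - g 0) * (pi / sqrt 5) * tan (sqrt 5 * pi / 2)
             + g 0 * (\<Sum>n. 1 / (real (n + 1) * ((real (n + 1))\<^sup>2 + real (n + 1) - 1))))"
proof -
  define q where "q n = (real (n + 1))\<^sup>2 + real (n + 1) - 1" for n
  define x where "x n = 1 / real (n + 2)" for n
  define T where "T = pi / sqrt 5 * tan (sqrt 5 * pi / 2)"
  define S where "S = (\<Sum>n. 1 / (real (n + 1) * q n))"
  have q_pos: "q n > 0" for n
    unfolding q_def by (rule golden_quadratic_pos)
  have rows: "(\<lambda>k. g (k + 1) * x n ^ (k + 2)) sums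
               (g 1 * (1 / q n) + g 0 * (1 / (real (n + 1) * q n) - 1 / q n + 1 / (real (n + 1) * real (n + 2))))"
    for n
  proof -
    have q: "q n = real (n + 1) * real (n + 2) - 1" "q n = (real (n + 2))\<^sup>2 - real (n + 2) - 1"
      by (auto simp: q_def power2_eq_square algebra_simps)
    have "x n * real (n + 2) = 1"
      by (simp add: x_def)
    then have xq: "1 - x n - (x n)\<^sup>2 = (x n)\<^sup>2 * q n"
      unfolding q(2) by algebra
    have "(x n)\<^sup>2 * (g 1 + g 0 * x n) / (1 - x n - (x n)\<^sup>2) = (g 1 + g 0 * x n) / q n"
      unfolding xq by (simp add: x_def)
    also have "\<dots> = g 1 * (1 / q n) + g 0 * (1 / (real (n + 2) * q n))"
      by (simp add: x_def add_divide_distrib)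
    also have "1 / (real (n + 2) * q n)
                 = 1 / (real (n + 1) * q n) - 1 / q n + 1 / (real (n + 1) * real (n + 2))"
      by (rule shifted_cubic_split[OF _ _ q_pos q(1)]) auto
    finally have gf: "(x n)\<^sup>2 * (g 1 + g 0 * x n) / (1 - x n - (x n)\<^sup>2)
        = g 1 * (1 / q n) + g 0 * (1 / (real (n + 1) * q n) - 1 / q n + 1 / (real (n + 1) * real (n + 2)))" .
    have "0 < x n" "x n \<le> 1/2"
      by (auto simp: x_def field_simps)
    from fib_like_gen_fun[of g, OF rec pos this] show ?thesis
      unfolding gf .
  qed
  have "(\<lambda>n. g 1 * (1 / q n) + g 0 * (1 / (real (n + 1) * q n) - 1 / q n + 1 / (real (n + 1) * real (n + 2))))
          sums (g 1 * (1 + T) + g 0 * (S - (1 + T) + 1))"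
  proof (intro sums_add sums_diff sums_mult sums_inverse_pronic)
    show "(\<lambda>n. 1 / q n) sums (1 + T)" "(\<lambda>n. 1 / q n) sums (1 + T)"
      unfolding q_def T_def by (rule sums_golden_quadratic)+
    show "(\<lambda>n. 1 / (real (n + 1) * q n)) sums S"
      unfolding S_def q_def by (intro summable_sums summable_golden_cubic)
  qed
  also have "g 1 * (1 + T) + g 0 * (S - (1 + T) + 1) = g 1 + (g 1 - g 0) * T + g 0 * S"
    by (simp add: algebra_simps)
  finally have "(\<lambda>k. g (k + 1) * (zeta (real (k + 2)) - 1)) sums (g 1 + (g 1 - g 0) * T + g 0 * S)"
  proof (rule sums_swap_nonneg[rotated 2])
    show "(\<lambda>n. g (k + 1) * x n ^ (k + 2)) sums (g (k + 1) * (zeta (real (k + 2)) - 1))" for k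
      unfolding x_def by (intro sums_mult zeta_minus_1_sums)
  qed (use rows pos in \<open>auto simp: x_def\<close>)
  then show ?thesis
    by (simp add: T_def S_def q_def mult_ac)
qed

lemma fibonacci_rec:
  "i \<ge> 0 \<Longrightarrow> fibonacci (i + 2) = fibonacci (i + 1) + fibonacci i"
  by (simp add: fibonacci_def nat_add_distrib numeral_2_eq_2)

lemma lucas_rec:
  "i \<ge> 0 \<Longrightarrow> lucas (i + 2) = lucas (i + 1) + lucas i"
  by (simp add: lucas_def nat_add_distrib numeral_2_eq_2)

lemma fibonacci_pred:
  assumes "m \<ge> 0"
  shows "fibonacci (m - 1) = fibonacci (m + 1) - fibonacci m"
proof (cases "m = 0")
  case False
  then show ?thesis
    using fibonacci_rec[of "m - 1"] assms by (simp add: algebra_simps)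
qed (simp add: fibonacci_def)

lemma lucas_pred:
  assumes "m \<ge> 0"
  shows "lucas (m - 1) = lucas (m + 1) - lucas m"
proof (cases "m = 0")
  case False
  then show ?thesis
    using lucas_rec[of "m - 1"] assms by (simp add: algebra_simps)
qed (simp add: lucas_def)

theorem theorem2p6:
  fixes m :: int
  assumes "m \<ge> 0"
  shows "((\<lambda>k::nat. (zeta (real (k + 2)) - 1) * real_of_int (fibonacci (int (k + 2) + m - 1)))
           sums (real_of_int (fibonacci (m + 1))
                 + real_of_int (fibonacci (m - 1)) * (pi / sqrt 5) * tan (sqrt 5 * pi / 2)
                 + real_of_int (fibonacci m)
                   * (\<Sum>n::nat. 1 / (real (n + 1) * ((real (n + 1))\<^sup>2 + real (n + 1) - 1))))) \<and>
         ((\<lambda>k::nat. (zeta (real (k + 2)) - 1) * real_of_int (lucas (int (k + 2) + m - 1)))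
           sums (real_of_int (lucas (m + 1))
                 + real_of_int (lucas (m - 1)) * (pi / sqrt 5) * tan (sqrt 5 * pi / 2)
                 + real_of_int (lucas m)
                   * (\<Sum>n::nat. 1 / (real (n + 1) * ((real (n + 1))\<^sup>2 + real (n + 1) - 1)))))"
proof -
  have index: "int (k + 2) + m - 1 = m + int (k + 1)" for k
    by simp
  have "(\<lambda>k. (zeta (real (k + 2)) - 1) * real_of_int (h (int (k + 2) + m - 1)))
           sums (real_of_int (h (m + 1))
                 + real_of_int (h (m - 1)) * (pi / sqrt 5) * tan (sqrt 5 * pi / 2)
                 + real_of_int (h m)
                   * (\<Sum>n::nat. 1 / (real (n + 1) * ((real (n + 1))\<^sup>2 + real (n + 1) - 1))))"
    if rec: "\<And>i. i \<ge> 0 \<Longrightarrow> h (i + 2) = h (i + 1) + h i" and nonneg: "\<And>i. i \<ge> 0 \<Longrightarrow> h i \<ge> 0"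
      and pred: "h (m - 1) = h (m + 1) - h m" for h :: "int \<Rightarrow> int"
  proof -
    have "real_of_int (h (m + int (n + 2))) = real_of_int (h (m + int (n + 1))) + real_of_int (h (m + int n))" for n
      using rec[of "m + int n"] assms by (simp add: add_ac)
    moreover have "real_of_int (h (m + int n)) \<ge> 0" for n
      using nonneg[of "m + int n"] assms by simp
    ultimately show ?thesis
      using zeta_fib_like_sums[of "\<lambda>n. real_of_int (h (m + int n))"]
      unfolding index pred by simp
  qed
  from this[of fibonacci] this[of lucas] show ?thesis
    using fibonacci_rec lucas_rec fibonacci_pred[OF assms] lucas_pred[OF assms]
    by (simp add: fibonacci_def lucas_def)
qed

end
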